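(* Let $b$ be a positive integer, $k=2b$, and let $v=(v_1,\ldots,v_b)$ be a $b$-tuple of pairwise distinct elements of $\{1,2,\ldots,2b-1\}$. For all integers $n>m\ge 0$, $$\sum_{i=0}^{k^n-1}(-1)^{N_{k,v}(i)}i^m=0.$$ In particular, for every nonnegative integer $n$ and every even integer $k\ge 2$, the set $\{0,1,\ldots,k^n-1\}$ can be partitioned into two disjoint subsets $P$ and $Q$ such that $$\sum_{i\in P}i^m=\sum_{i\in Q}i^m\qquad\text{for each } m=0,1,\ldots,n-1.$$
   Context: For a digit $l\in\{0,\ldots,k-1\}$, $N_k(l,i)$ is the number of occurrences of the digit $l$ in the base-$k$ expansion of the nonnegative integer $i$. For $v=(v_1,\ldots,v_b)$ put $N_{k,v}(i)=\sum_{j=1}^bN_k(v_j,i)$. The convention $0^0=1$ is used. *)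

theory Defs
  imports Main
begin

text \<open>
  The base-\<open>k\<close> expansion of \<open>i\<close>, least significant digit first, without leading zeros;
  the expansion of \<open>0\<close> is \<open>[0]\<close>. Only bases \<open>k \<ge> 2\<close> are meaningful:
  the test \<open>k < 2\<close> is there to make the recursion terminate.
\<close>

fun base_expansion :: "nat \<Rightarrow> nat \<Rightarrow> nat list" where
  "base_expansion k i =
     (if k < 2 \<or> i < k then [i] else (i mod k) # base_expansion k (i div k))"

declare base_expansion.simps [simp del]

definition digit_count :: "nat \<Rightarrow> nat \<Rightarrow> nat \<Rightarrow> nat" where
  "digit_count k l i = count_list (base_expansion k i) l"

definition digits_count :: "nat \<Rightarrow> nat list \<Rightarrow> nat \<Rightarrow> nat" where
  "digits_count k v i = (\<Sum>j<length v. digit_count k (v ! j) i)"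

lemma horner_sum_base_expansion: "horner_sum (\<lambda>d. d) k (base_expansion k i) = i"
proof (induction k i rule: base_expansion.induct)
  case (1 k i)
  then show ?case
    by (subst base_expansion.simps) auto
qed

lemma base_expansion_digit_less:
  "k \<ge> 2 \<Longrightarrow> d \<in> set (base_expansion k i) \<Longrightarrow> d < k"
proof (induction k i rule: base_expansion.induct)
  case (1 k i)
  then show ?case
    by (cases "i < k") (auto simp: base_expansion.simps[of k i])
qed

lemma last_base_expansion_nonzero:
  "k \<ge> 2 \<Longrightarrow> i > 0 \<Longrightarrow> last (base_expansion k i) \<noteq> 0"
proof (induction k i rule: base_expansion.induct)
  case (1 k i)
  have "base_expansion k (i div k) \<noteq> []"
    by (subst base_expansion.simps) simp
  with 1 show ?case
    by (subst base_expansion.simps) (auto simp: div_greater_zero_iff)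
qed

end

theory Submission
  imports Defs
begin

text \<open>
  The sign \<open>s i = (-1) ^ digits_count k v i\<close> is multiplicative along base-\<open>k\<close> expansions:
  \<open>s (q * k + r) = s q * s r\<close> for a digit \<open>r\<close>. Here it matters that \<open>0\<close> is not among the
  distinguished digits, so that leading zeros do not change the sign. Exactly half of the \<open>k\<close>
  digits are distinguished, so the signs of the digits sum to \<open>0\<close>
  (\<open>sum_digits_count_sign_eq_0\<close>).

  These two properties alone make the moments vanish
  (\<open>vanishing_moments_of_digit_multiplicative\<close>). Splitting \<open>i < k ^ Suc n\<close> as \<open>i = q * k + r\<close> and
  expanding \<open>(q * k + r) ^ m\<close> binomially turns the \<open>m\<close>-th moment of \<open>s\<close> up to \<open>k ^ Suc n\<close> into a
  combination of products of a \<open>j\<close>-th moment up to \<open>k ^ n\<close> and an \<open>(m - j)\<close>-th moment up to \<open>k\<close>,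
  with \<open>j \<le> m\<close>. The first factor vanishes by induction if \<open>j < m\<close>; the second one is the
  sum of the digit signs if \<open>j = m\<close>. So every additional digit kills one more moment.

  The partition is then the one according to the sign, for any choice of half of the nonzero
  digits, such as \<open>1, \<dots>, b\<close>.
\<close>

lemma sum_lessThan_mult_split:
  fixes f :: "nat \<Rightarrow> 'a::comm_monoid_add"
  shows "(\<Sum>i<N * k. f i) = (\<Sum>q<N. \<Sum>r<k. f (q * k + r))"
proof -
  have "sum f {q * k..<q * k + k} = (\<Sum>r<k. f (q * k + r))" for q
    using sum.shift_bounds_nat_ivl[of f 0 "q * k" k]
    by (simp add: add.commute lessThan_atLeast0)
  then show ?thesis
    using sum.nat_group[of f k N] by simp
qed

lemma vanishing_moments_of_digit_multiplicative:
  fixes s :: "nat \<Rightarrow> 'a::comm_ring_1"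
  assumes mult: "\<And>q r. r < k \<Longrightarrow> s (q * k + r) = s q * s r"
    and digits: "(\<Sum>r<k. s r) = 0"
  shows "m < n \<Longrightarrow> (\<Sum>i<k ^ n. s i * of_nat i ^ m) = 0"
proof (induction n arbitrary: m)
  case 0
  then show ?case by simp
next
  case (Suc n)
  define M where "M j = (\<Sum>q<k ^ n. s q * of_nat q ^ j)" for j
  define D where "D j = (\<Sum>r<k. s r * of_nat r ^ j)" for j
  have "(\<Sum>i<k ^ Suc n. s i * of_nat i ^ m)
      = (\<Sum>q<k ^ n. \<Sum>r<k. s (q * k + r) * of_nat (q * k + r) ^ m)"
    using sum_lessThan_mult_split[of "\<lambda>i. s i * of_nat i ^ m" "k ^ n" k]
    by (simp add: mult.commute)
  also have "\<dots> = (\<Sum>q<k ^ n. \<Sum>r<k. \<Sum>j\<le>m.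
      of_nat (m choose j) * of_nat k ^ j * ((s q * of_nat q ^ j) * (s r * of_nat r ^ (m - j))))"
  proof (intro sum.cong refl)
    fix q r assume "r \<in> {..<k}"
    then have "s (q * k + r) * of_nat (q * k + r) ^ m
        = s q * s r * (of_nat q * of_nat k + of_nat r) ^ m"
      by (simp add: mult)
    then show "s (q * k + r) * of_nat (q * k + r) ^ m = (\<Sum>j\<le>m.
        of_nat (m choose j) * of_nat k ^ j * ((s q * of_nat q ^ j) * (s r * of_nat r ^ (m - j))))"
      by (simp add: binomial_ring sum_distrib_left power_mult_distrib mult_ac)
  qed
  also have "\<dots> = (\<Sum>q<k ^ n. \<Sum>j\<le>m. \<Sum>r<k.
      of_nat (m choose j) * of_nat k ^ j * ((s q * of_nat q ^ j) * (s r * of_nat r ^ (m - j))))"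
    by (intro sum.cong refl sum.swap)
  also have "\<dots> = (\<Sum>j\<le>m. \<Sum>q<k ^ n. \<Sum>r<k.
      of_nat (m choose j) * of_nat k ^ j * ((s q * of_nat q ^ j) * (s r * of_nat r ^ (m - j))))"
    by (rule sum.swap)
  also have "\<dots> = (\<Sum>j\<le>m. of_nat (m choose j) * of_nat k ^ j * (M j * D (m - j)))"
    unfolding M_def D_def sum_product by (simp add: sum_distrib_left)
  also have "\<dots> = 0"
  proof (intro sum.neutral ballI)
    fix j assume "j \<in> {..m}"
    then consider "j < m" | "j = m" by fastforce
    then show "of_nat (m choose j) * of_nat k ^ j * (M j * D (m - j)) = 0"
    proof cases
      case 1
      then have "M j = 0"
        using Suc.IH[of j] Suc.prems by (simp add: M_def)
      then show ?thesis by simp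
    next
      case 2
      then have "D (m - j) = 0"
        using digits by (simp add: D_def)
      then show ?thesis by simp
    qed
  qed
  finally show ?case .
qed

lemma digit_count_digit:
  "r < k \<Longrightarrow> digit_count k l r = of_bool (r = l)"
  by (simp add: digit_count_def base_expansion.simps[of k r])

text \<open>
  For \<open>q = 0\<close> the expansion of \<open>q * k + r\<close> is just \<open>[r]\<close>, whereas \<open>0\<close> itself has the
  expansion \<open>[0]\<close>; hence \<open>l \<noteq> 0\<close>.
\<close>

lemma digit_count_append_digit:
  assumes "2 \<le> k" "r < k" "l \<noteq> 0"
  shows "digit_count k l (q * k + r) = digit_count k l q + digit_count k l r"
proof (cases "q = 0")
  case True
  then show ?thesis
    using assms by (simp add: digit_count_digit)
next
  case False
  then have "k \<le> q * k + r"
    by (simp add: trans_le_add1)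
  then have "base_expansion k (q * k + r) = r # base_expansion k q"
    using assms by (simp add: base_expansion.simps[of k "q * k + r"])
  then show ?thesis
    using assms by (simp add: digit_count_def base_expansion.simps[of k r])
qed

lemma digits_count_append_digit:
  assumes "2 \<le> k" "r < k" "0 \<notin> set v"
  shows "digits_count k v (q * k + r) = digits_count k v q + digits_count k v r"
proof -
  have "v ! j \<noteq> 0" if "j < length v" for j
    using that assms(3) by (metis nth_mem)
  then show ?thesis
    using assms by (simp add: digits_count_def digit_count_append_digit sum.distrib)
qed

lemma digits_count_digit:
  assumes "r < k" "distinct v"
  shows "digits_count k v r = of_bool (r \<in> set v)"
proof -
  have "digits_count k v r = (\<Sum>j<length v. of_bool (r = v ! j))"
    using assms(1) by (simp add: digits_count_def digit_count_digit)
  also have "\<dots> = (\<Sum>l\<in>set v. of_bool (r = l))"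
    using assms(2) by (intro sum.reindex_bij_betw bij_betw_nth) auto
  also have "\<dots> = of_bool (r \<in> set v)"
    by (simp add: of_bool_def)
  finally show ?thesis .
qed

lemma sum_digits_count_sign_eq_0:
  assumes "distinct v" "set v \<subseteq> {..<2 * length v}"
  shows "(\<Sum>r<2 * length v. (- 1) ^ digits_count (2 * length v) v r) = (0::int)"
proof -
  let ?k = "2 * length v"
  have "(\<Sum>r<?k. (- 1) ^ digits_count ?k v r) = (\<Sum>r<?k. if r \<in> set v then - 1 else (1::int))"
    using assms(1) by (intro sum.cong) (auto simp: digits_count_digit)
  also have "\<dots> = int (card ({..<?k} - set v)) - int (card (set v))"
    using assms(2) by (simp add: sum.If_cases Int_absorb1 Diff_eq)
  also have "\<dots> = 0"
    using assms by (simp add: card_Diff_subset distinct_card)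
  finally show ?thesis .
qed

lemma vanishing_moments_digits_count_sign:
  fixes v :: "nat list"
  assumes "v \<noteq> []" "distinct v" "set v \<subseteq> {1..2 * length v - 1}" "m < n"
  shows "(\<Sum>i<(2 * length v) ^ n. (- 1) ^ digits_count (2 * length v) v i * int i ^ m) = 0"
proof (rule vanishing_moments_of_digit_multiplicative)
  let ?k = "2 * length v"
  have "2 \<le> ?k"
    using assms(1) by (cases v) auto
  moreover have "0 \<notin> set v"
    using assms(3) by auto
  ultimately show "(- 1 :: int) ^ digits_count ?k v (q * ?k + r)
      = (- 1) ^ digits_count ?k v q * (- 1) ^ digits_count ?k v r" if "r < ?k" for q r
    using that by (simp add: digits_count_append_digit power_add)
  show "(\<Sum>r<?k. (- 1) ^ digits_count ?k v r) = (0::int)"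
    using assms(2,3) by (intro sum_digits_count_sign_eq_0) fastforce+
qed (rule assms(4))

lemma sum_even_eq_sum_odd_of_signed_sum_eq_0:
  fixes c f :: "nat \<Rightarrow> nat"
  assumes "finite A" "(\<Sum>i\<in>A. (- 1) ^ c i * int (f i)) = 0"
  shows "(\<Sum>i\<in>{i \<in> A. even (c i)}. f i) = (\<Sum>i\<in>{i \<in> A. odd (c i)}. f i)"
proof -
  have "0 = (\<Sum>i\<in>A. if even (c i) then int (f i) else - int (f i))"
    unfolding assms(2)[symmetric] by (intro sum.cong) auto
  also have "\<dots> = int (\<Sum>i\<in>{i \<in> A. even (c i)}. f i) - int (\<Sum>i\<in>{i \<in> A. odd (c i)}. f i)"
    using assms(1) by (simp add: sum.If_cases sum_negf Int_def)
  finally show ?thesis by linarith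
qed

theorem theorem3p2:
  shows "(\<forall>(b::nat) (k::nat) (v::nat list).
            b > 0 \<and> k = 2 * b \<and>
            length v = b \<and> distinct v \<and> set v \<subseteq> {1..2 * b - 1} \<longrightarrow>
            (\<forall>(n::nat) (m::nat). n > m \<longrightarrow>
              (\<Sum>i = 0..k ^ n - 1. (- 1) ^ digits_count k v i * int i ^ m) = 0))
       \<and> (\<forall>(n::nat) (k::nat). even k \<and> k \<ge> 2 \<longrightarrow>
            (\<exists>P Q :: nat set.
              P \<union> Q = {0..k ^ n - 1} \<and> P \<inter> Q = {} \<and>
              (\<forall>m<n. (\<Sum>i\<in>P. i ^ m) = (\<Sum>i\<in>Q. i ^ m))))"
proof -
  have range: "{0..k ^ n - 1} = {..<k ^ n}" if "0 < k" for k n :: nat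
    using lessThan_Suc_atMost[of "k ^ n - 1"] that by (simp add: atLeast0AtMost)
  have moments: "(\<Sum>i = 0..k ^ n - 1. (- 1) ^ digits_count k v i * int i ^ m) = 0"
    if "b > 0" "k = 2 * b" "length v = b" "distinct v" "set v \<subseteq> {1..2 * b - 1}" "m < n"
    for b k n m :: nat and v
  proof -
    have "v \<noteq> []" "0 < k" using that by auto
    then show ?thesis
      using vanishing_moments_digits_count_sign[of v m n] that unfolding range[OF \<open>0 < k\<close>]
      by metis
  qed
  have "\<exists>P Q :: nat set. P \<union> Q = {0..k ^ n - 1} \<and> P \<inter> Q = {} \<and>
      (\<forall>m<n. (\<Sum>i\<in>P. i ^ m) = (\<Sum>i\<in>Q. i ^ m))"
    if "even k" "k \<ge> 2" for n k :: nat
  proof -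
    from that obtain b where k: "k = 2 * b" "b > 0" by (auto elim: evenE)
    define c where "c = digits_count k [1..<Suc b]"
    define A where "A = {0..k ^ n - 1}"
    have "set [1..<Suc b] \<subseteq> {1..2 * b - 1}"
      by auto
    then have "(\<Sum>i\<in>A. (- 1) ^ c i * int (i ^ m)) = 0" if "m < n" for m
      using moments[of b k "[1..<Suc b]" m n] k that unfolding A_def c_def of_nat_power
      by (metis diff_Suc_1 distinct_upt length_upt)
    then have "\<forall>m<n. (\<Sum>i\<in>{i \<in> A. even (c i)}. i ^ m) = (\<Sum>i\<in>{i \<in> A. odd (c i)}. i ^ m)"
      using sum_even_eq_sum_odd_of_signed_sum_eq_0[of A c] by (simp add: A_def)
    moreover have "{i \<in> A. even (c i)} \<union> {i \<in> A. odd (c i)} = A"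
      "{i \<in> A. even (c i)} \<inter> {i \<in> A. odd (c i)} = {}" by auto
    ultimately show ?thesis
      unfolding A_def by blast
  qed
  with moments show ?thesis by presburger
qed

end
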